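(* Let $\mathbb{X}$ be a reflexive complex Banach space and $\mathbb{Y}$ be any complex Banach space. Let $T, A \in \mathbb{K}(\mathbb{X},\mathbb{Y})$. Then $T \perp_B A$ if and only if there exist $x, y, z, w \in M_T$ and $\phi_1, \phi_2 \in [0,\pi]$ such that (i) $Ax \in (Tx)_\alpha^{+}$ for all $\alpha$ with $\arg\alpha \in [0,\phi_1]$, (ii) $Ay \in (Ty)_\alpha^{+}$ for all $\alpha$ with $\arg\alpha \in [\phi_1,\pi]$, (iii) $Az \in (Tz)_\alpha^{-}$ for all $\alpha$ with $\arg\alpha \in [0,\phi_2]$, (iv) $Aw \in (Tw)_\alpha^{-}$ for all $\alpha$ with $\arg\alpha \in [\phi_2,\pi]$.
   Context: The domain space $\mathbb{X}$ is assumed non-zero. $\mathbb{K}(\mathbb{X},\mathbb{Y})$ is the space of compact linear operators from $\mathbb{X}$ to $\mathbb{Y}$ with the operator norm, $S_{\mathbb{X}} = \{x \in \mathbb{X} : \|x\| = 1\}$, and $M_T = \{x \in S_{\mathbb{X}} : \|Tx\| = \|T\|\}$. For operators, $T \perp_B A$ (Birkhoff-James orthogonality) means $\|T + \lambda A\| \ge \|T\|$ for all $\lambda \in \mathbb{C}$. Here $\alpha$ always denotes a complex number with $|\alpha| = 1$, and "$\arg\alpha \in I$" for an interval $I$ means $\alpha = e^{i\phi}$ for some $\phi \in I$. For an element $u$ of a complex Banach space $\mathbb{Z}$ and $|\alpha| = 1$, $$u_\alpha^{+} = \{v \in \mathbb{Z} : \|u + t\alpha v\| \ge \|u\| \text{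 for all real } t \ge 0\},\qquad u_\alpha^{-} = \{v \in \mathbb{Z} : \|u + t\alpha v\| \ge \|u\| \text{ for all real } t \le 0\}$$ (so that $u_{-\alpha}^{+} = u_\alpha^{-}$ and $u_{-\alpha}^{-} = u_\alpha^{+}$). *)

theory Defs
  imports "HOL-Analysis.Analysis"
begin

section \<open>Complex normed spaces\<close>

class complex_normed_vector = real_normed_vector +
  fixes scaleC :: "complex \<Rightarrow> 'a \<Rightarrow> 'a"  (infixr "*\<^sub>C" 75)
  assumes scaleC_add_right: "c *\<^sub>C (x + y) = c *\<^sub>C x + c *\<^sub>C y"
    and scaleC_add_left: "(c + d) *\<^sub>C x = c *\<^sub>C x + d *\<^sub>C x"
    and scaleC_scaleC: "c *\<^sub>C d *\<^sub>C x = (c * d) *\<^sub>C x"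
    and scaleC_complex_of_real: "complex_of_real r *\<^sub>C x = r *\<^sub>R x"
    and norm_scaleC: "norm (c *\<^sub>C x) = cmod c * norm x"

instantiation complex :: complex_normed_vector
begin

definition scaleC_complex :: "complex \<Rightarrow> complex \<Rightarrow> complex"
  where "scaleC_complex c x = c * x"

instance
  by standard (simp_all add: scaleC_complex_def algebra_simps norm_mult scaleR_conv_of_real)

end

text \<open>Complete spaces are expressed by the sort \<open>{complex_normed_vector, banach}\<close>.\<close>

lemma scaleC_scaleR_commute:
  fixes x :: "'a::complex_normed_vector"
  shows "c *\<^sub>C r *\<^sub>R x = r *\<^sub>R c *\<^sub>C x"
  by (simp flip: scaleC_complex_of_real add: scaleC_scaleC mult.commute)

lemma scaleC_one [simp]:
  fixes x :: "'a::complex_normed_vector"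
  shows "1 *\<^sub>C x = x"
  using scaleC_complex_of_real[of 1 x] by simp

lemma bounded_linear_scaleC:
  "bounded_linear ((*\<^sub>C) c :: 'a \<Rightarrow> 'a::complex_normed_vector)"
  by (rule bounded_linear_intro[where K = "cmod c"])
    (simp_all add: scaleC_add_right scaleC_scaleR_commute norm_scaleC)

lemma scaleC_zero_right [simp]: "c *\<^sub>C (0::'a::complex_normed_vector) = 0"
  by (rule linear_0[OF bounded_linear.linear[OF bounded_linear_scaleC]])

lemma scaleC_minus_right: "c *\<^sub>C (- x) = - (c *\<^sub>C (x::'a::complex_normed_vector))"
  by (rule linear_neg[OF bounded_linear.linear[OF bounded_linear_scaleC]])

lemma scaleC_diff_right: "c *\<^sub>C (x - y) = c *\<^sub>C x - c *\<^sub>C (y::'a::complex_normed_vector)"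
  by (rule linear_diff[OF bounded_linear.linear[OF bounded_linear_scaleC]])

section \<open>The normed space of bounded complex-linear operators\<close>

definition bounded_clinear :: "('a::complex_normed_vector \<Rightarrow> 'b::complex_normed_vector) \<Rightarrow> bool"
  where "bounded_clinear f \<longleftrightarrow> bounded_linear f \<and> (\<forall>c x. f (c *\<^sub>C x) = c *\<^sub>C f x)"

typedef (overloaded) ('a, 'b) cblinfun (\<open>(_ \<Rightarrow>\<^sub>C\<^sub>L /_)\<close> [22, 21] 21) =
  "{f :: 'a::complex_normed_vector \<Rightarrow> 'b::complex_normed_vector. bounded_clinear f}"
  morphisms cblinfun_apply CBlinfun
  by (rule exI[where x = "\<lambda>_. 0"]) (simp add: bounded_clinear_def)

setup_lifting type_definition_cblinfun

instantiation cblinfun :: (complex_normed_vector, complex_normed_vector) complex_normed_vector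
begin

lift_definition norm_cblinfun :: "('a \<Rightarrow>\<^sub>C\<^sub>L 'b) \<Rightarrow> real" is onorm .

lift_definition zero_cblinfun :: "'a \<Rightarrow>\<^sub>C\<^sub>L 'b" is "\<lambda>_. 0"
  by (simp add: bounded_clinear_def)

lift_definition plus_cblinfun :: "('a \<Rightarrow>\<^sub>C\<^sub>L 'b) \<Rightarrow> ('a \<Rightarrow>\<^sub>C\<^sub>L 'b) \<Rightarrow> 'a \<Rightarrow>\<^sub>C\<^sub>L 'b"
  is "\<lambda>f g x. f x + g x"
  by (simp add: bounded_clinear_def bounded_linear_add scaleC_add_right)

lift_definition minus_cblinfun :: "('a \<Rightarrow>\<^sub>C\<^sub>L 'b) \<Rightarrow> ('a \<Rightarrow>\<^sub>C\<^sub>L 'b) \<Rightarrow> 'a \<Rightarrow>\<^sub>C\<^sub>L 'b"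
  is "\<lambda>f g x. f x - g x"
  by (simp add: bounded_clinear_def bounded_linear_sub scaleC_diff_right)

lift_definition uminus_cblinfun :: "('a \<Rightarrow>\<^sub>C\<^sub>L 'b) \<Rightarrow> 'a \<Rightarrow>\<^sub>C\<^sub>L 'b" is "\<lambda>f x. - f x"
  by (simp add: bounded_clinear_def bounded_linear_minus scaleC_minus_right)

lift_definition scaleR_cblinfun :: "real \<Rightarrow> ('a \<Rightarrow>\<^sub>C\<^sub>L 'b) \<Rightarrow> 'a \<Rightarrow>\<^sub>C\<^sub>L 'b" is "\<lambda>r f x. r *\<^sub>R f x"
  by (simp add: bounded_clinear_def bounded_linear_const_scaleR scaleC_scaleR_commute)

lift_definition scaleC_cblinfun :: "complex \<Rightarrow> ('a \<Rightarrow>\<^sub>C\<^sub>L 'b) \<Rightarrow> 'a \<Rightarrow>\<^sub>C\<^sub>L 'b" is "\<lambda>c f x. c *\<^sub>C f x"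
  by (simp add: bounded_clinear_def bounded_linear_compose[OF bounded_linear_scaleC]
      scaleC_scaleC mult.commute)

definition dist_cblinfun :: "('a \<Rightarrow>\<^sub>C\<^sub>L 'b) \<Rightarrow> ('a \<Rightarrow>\<^sub>C\<^sub>L 'b) \<Rightarrow> real"
  where "dist_cblinfun f g = norm (f - g)"

definition sgn_cblinfun :: "('a \<Rightarrow>\<^sub>C\<^sub>L 'b) \<Rightarrow> 'a \<Rightarrow>\<^sub>C\<^sub>L 'b"
  where "sgn_cblinfun f = inverse (norm f) *\<^sub>R f"

definition uniformity_cblinfun :: "(('a \<Rightarrow>\<^sub>C\<^sub>L 'b) \<times> ('a \<Rightarrow>\<^sub>C\<^sub>L 'b)) filter"
  where "uniformity_cblinfun = (INF e\<in>{0<..}. principal {(f, g). dist f g < e})"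

definition open_cblinfun :: "('a \<Rightarrow>\<^sub>C\<^sub>L 'b) set \<Rightarrow> bool"
  where "open_cblinfun S \<longleftrightarrow> (\<forall>f\<in>S. \<forall>\<^sub>F (f', g) in uniformity. f' = f \<longrightarrow> g \<in> S)"

instance
proof
  fix f g h :: "'a \<Rightarrow>\<^sub>C\<^sub>L 'b" and r s :: real and c d :: complex and S :: "('a \<Rightarrow>\<^sub>C\<^sub>L 'b) set"
  show "f + g + h = f + (g + h)" "f + g = g + f" "0 + f = f" "- f + f = 0" "f - g = f + - g"
    by (transfer, force)+
  show "r *\<^sub>R (f + g) = r *\<^sub>R f + r *\<^sub>R g" "(r + s) *\<^sub>R f = r *\<^sub>R f + s *\<^sub>R f"
    "r *\<^sub>R s *\<^sub>R f = (r * s) *\<^sub>R f" "1 *\<^sub>R f = f"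
    by (transfer, force simp: algebra_simps)+
  show "c *\<^sub>C (f + g) = c *\<^sub>C f + c *\<^sub>C g" "(c + d) *\<^sub>C f = c *\<^sub>C f + d *\<^sub>C f"
    "c *\<^sub>C d *\<^sub>C f = (c * d) *\<^sub>C f" "complex_of_real r *\<^sub>C f = r *\<^sub>R f"
    by (transfer, simp add: scaleC_add_right scaleC_add_left scaleC_scaleC scaleC_complex_of_real)+
  show "dist f g = norm (f - g)" "sgn f = inverse (norm f) *\<^sub>R f"
    by (simp_all add: dist_cblinfun_def sgn_cblinfun_def)
  show "uniformity = (INF e\<in>{0<..}. principal {(f, g :: 'a \<Rightarrow>\<^sub>C\<^sub>L 'b). dist f g < e})"
    by (rule uniformity_cblinfun_def)
  show "open S \<longleftrightarrow> (\<forall>f\<in>S. \<forall>\<^sub>F (f', g) in uniformity. f' = f \<longrightarrow> g \<in> S)"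
    by (rule open_cblinfun_def)
  show "norm f = 0 \<longleftrightarrow> f = 0"
    by transfer (auto simp: bounded_clinear_def onorm_eq_0)
  show "norm (f + g) \<le> norm f + norm g"
    by transfer (simp add: bounded_clinear_def onorm_triangle)
  show "norm (r *\<^sub>R f) = \<bar>r\<bar> * norm f"
    by transfer (simp add: bounded_clinear_def onorm_scaleR)
  show "norm (c *\<^sub>C f) = cmod c * norm f"
  proof transfer
    fix c and f :: "'a \<Rightarrow> 'b"
    assume "bounded_clinear f"
    then have "onorm (\<lambda>x. cmod c *\<^sub>R f x) = cmod c * onorm f"
      by (simp add: bounded_clinear_def onorm_scaleR)
    then show "onorm (\<lambda>x. c *\<^sub>C f x) = cmod c * onorm f"
      by (simp add: onorm_def norm_scaleC)
  qed
qed

end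

declare [[coercion
  "cblinfun_apply :: ('a::complex_normed_vector \<Rightarrow>\<^sub>C\<^sub>L 'b::complex_normed_vector) \<Rightarrow> 'a \<Rightarrow> 'b"]]

section \<open>Reflexivity and compact operators\<close>

text \<open>The canonical embedding into the bidual sends \<open>x\<close> to the functional \<open>f \<mapsto> f x\<close>.\<close>

lift_definition bidual_embedding ::
    "'a::complex_normed_vector \<Rightarrow> (('a \<Rightarrow>\<^sub>C\<^sub>L complex) \<Rightarrow>\<^sub>C\<^sub>L complex)"
  is "\<lambda>x f. cblinfun_apply f x"
proof -
  fix x :: 'a
  have "bounded_linear (\<lambda>f :: 'a \<Rightarrow>\<^sub>C\<^sub>L complex. cblinfun_apply f x)"
  proof (rule bounded_linear_intro[where K = "norm x"])
    fix f :: "'a \<Rightarrow>\<^sub>C\<^sub>L complex"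
    show "norm (cblinfun_apply f x) \<le> norm f * norm x"
      by transfer (simp add: bounded_clinear_def onorm)
  qed (transfer, simp)+
  then show "bounded_clinear (\<lambda>f :: 'a \<Rightarrow>\<^sub>C\<^sub>L complex. cblinfun_apply f x)"
    by (simp add: bounded_clinear_def scaleC_cblinfun.rep_eq)
qed

definition reflexive_space :: "'a::complex_normed_vector itself \<Rightarrow> bool"
  where "reflexive_space _ \<longleftrightarrow>
    surj (bidual_embedding :: 'a \<Rightarrow> (('a \<Rightarrow>\<^sub>C\<^sub>L complex) \<Rightarrow>\<^sub>C\<^sub>L complex))"

definition compact_operators :: "('a::complex_normed_vector \<Rightarrow>\<^sub>C\<^sub>L 'b::complex_normed_vector) set"
  where "compact_operators = {T. compact (closure (cblinfun_apply T ` cball 0 1))}"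

section \<open>Norm attainment and Birkhoff-James orthogonality\<close>

definition norm_attain_set ::
    "('a::complex_normed_vector \<Rightarrow>\<^sub>C\<^sub>L 'b::complex_normed_vector) \<Rightarrow> 'a set"
  where "norm_attain_set T = {x. norm x = 1 \<and> norm (T x) = norm T}"

definition bj_orthogonal :: "'a::complex_normed_vector \<Rightarrow> 'a \<Rightarrow> bool"  (infix "\<bottom>\<^sub>B" 50)
  where "u \<bottom>\<^sub>B v \<longleftrightarrow> (\<forall>c. norm (u + c *\<^sub>C v) \<ge> norm u)"

definition plus_set :: "complex \<Rightarrow> 'a::complex_normed_vector \<Rightarrow> 'a set"
  where "plus_set \<alpha> u = {v. \<forall>t::real. t \<ge> 0 \<longrightarrow> norm (u + (complex_of_real t * \<alpha>) *\<^sub>C v) \<ge> norm u}"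

definition minus_set :: "complex \<Rightarrow> 'a::complex_normed_vector \<Rightarrow> 'a set"
  where "minus_set \<alpha> u = {v. \<forall>t::real. t \<le> 0 \<longrightarrow> norm (u + (complex_of_real t * \<alpha>) *\<^sub>C v) \<ge> norm u}"

text \<open>\<open>arg_in \<alpha> I\<close> says that \<open>\<alpha> = e\<^sup>i\<^sup>\<phi>\<close> for some \<open>\<phi> \<in> I\<close>; in particular \<open>\<bar>\<alpha>\<bar> = 1\<close>.
  It is not phrased with the principal argument \<^const>\<open>Arg\<close>.\<close>

definition arg_in :: "complex \<Rightarrow> real set \<Rightarrow> bool"
  where "arg_in \<alpha> I \<longleftrightarrow> (\<exists>\<phi>\<in>I. \<alpha> = exp (\<i> * complex_of_real \<phi>))"

end

theory Submission
  imports Defs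
begin

text \<open>If \<open>c = t e\<^sup>i\<^sup>\<theta>\<close> with \<open>t \<ge> 0\<close>, then one of the four vectors does not lose norm in the
  direction \<open>c\<close>, and a norm attaining vector \<open>v\<close> with \<open>\<parallel>T v + c A v\<parallel> \<ge> \<parallel>T v\<parallel> = \<parallel>T\<parallel>\<close> forces
  \<open>\<parallel>T + c A\<parallel> \<ge> \<parallel>T\<parallel>\<close>. All the work is in the converse, where it suffices to find \<open>x\<close>, \<open>y\<close>
  and \<open>\<phi>\<^sub>1\<close>: the other three come from the same result for \<open>- A\<close>.

  Three facts carry the converse. First, by reflexivity and compactness of the two operators, the
  set of pairs \<open>(T x, A x)\<close> with \<open>\<parallel>x\<parallel> \<le> 1\<close> is sequentially compact
  (\<open>compact_operators_subseq_limit\<close>). Near-maximizers of the norm of \<open>T + e\<^sub>n \<alpha> A\<close>, where \<open>e\<^sub>n\<close>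
  decreases to \<open>0\<close>, therefore converge in this sense, and convexity of the norm along a ray shows
  that the limit \<open>z\<close> attains the norm of \<open>T\<close> and satisfies \<open>A z \<in> (T z)\<^sub>\<alpha>\<^sup>+\<close>
  (\<open>bj_orthogonal_attains_direction\<close>). So each single direction has its own vector.

  Second, the directions in which \<open>v\<close> shrinks \<open>u\<close> are those whose ray meets the convex set
  \<open>{c. \<parallel>u + c v\<parallel> < \<parallel>u\<parallel>}\<close>, and this set misses \<open>0\<close>. Hence in the upper half plane a direction
  \<open>\<phi>\<close> that does not shrink cannot lie between two that do: \<open>v\<close> works either on all of
  \<open>[0,\<phi>]\<close> or on all of \<open>[\<phi>,\<pi>]\<close> (\<open>plus_set_sector\<close>).

  Third, the set \<open>P\<close> of those \<open>\<phi>\<close> for which one vector works on \<open>[0,\<phi>]\<close>, and the set \<open>Q\<close> of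
  those for which one vector works on \<open>[\<phi>,\<pi>]\<close>, are closed, again by sequential compactness. They
  cover \<open>[0,\<pi>]\<close> by the two previous facts, and contain \<open>0\<close> and \<open>\<pi>\<close> respectively. As the
  interval is connected they meet, and a common point is \<open>\<phi>\<^sub>1\<close>.

  Sequential compactness itself rests on the Hahn-Banach theorem, which serves three times: it gives
  norming functionals on both spaces, and a functional on the dual space that is dominated by
  the upper limit of \<open>Re (f (x\<^sub>n))\<close>. By reflexivity the latter is evaluation at a vector.\<close>

section \<open>The Hahn-Banach theorem by minimal sublinear functionals\<close>

text \<open>Homogeneity is required only as an inequality, which keeps it easy to verify for infima; equality
  follows, see \<open>sublinear_scaleR\<close>.\<close>

definition sublinear :: "('a::real_vector \<Rightarrow> real) \<Rightarrow> bool" where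
  "sublinear p \<longleftrightarrow> (\<forall>x y. p (x + y) \<le> p x + p y) \<and> (\<forall>c\<ge>0. \<forall>x. p (c *\<^sub>R x) \<le> c * p x)"

lemma sublinear_add: "sublinear p \<Longrightarrow> p (x + y) \<le> p x + p y"
  by (simp add: sublinear_def)

lemma sublinear_scaleR_le: "sublinear p \<Longrightarrow> 0 \<le> c \<Longrightarrow> p (c *\<^sub>R x) \<le> c * p x"
  by (simp add: sublinear_def)

lemma sublinear_0: "sublinear p \<Longrightarrow> p 0 = 0"
  using sublinear_add[of p 0 0] sublinear_scaleR_le[of p 0 0] by simp

lemma sublinear_minus: "sublinear p \<Longrightarrow> - p (- x) \<le> p x"
  using sublinear_add[of p x "- x"] sublinear_0[of p] by simp

lemma sublinear_scaleR:
  assumes p: "sublinear p" and c: "0 \<le> c"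
  shows "p (c *\<^sub>R x) = c * p x"
proof (cases "c = 0")
  case False
  then have "p (inverse c *\<^sub>R c *\<^sub>R x) \<le> inverse c * p (c *\<^sub>R x)"
    using sublinear_scaleR_le[OF p, of "inverse c" "c *\<^sub>R x"] c by simp
  then have "c * p x \<le> p (c *\<^sub>R x)"
    using False c by (simp add: field_simps)
  then show ?thesis
    using sublinear_scaleR_le[OF p c, of x] by simp
qed (simp add: sublinear_0[OF p])

text \<open>A common source of sublinear functionals: the infimum of the eventual upper bounds of a sequence, over a
  ray, and over a chain of functionals are all of this shape. The hypotheses say that the sets
  \<open>S x\<close> behave like the sets of admissible upper bounds for the value at \<open>x\<close>.\<close>

lemma sublinear_Inf:
  fixes S :: "'a::real_vector \<Rightarrow> real set"
  assumes ne: "\<And>x. S x \<noteq> {}" and bdd: "\<And>x. bdd_below (S x)"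
    and add: "\<And>x y a b. a \<in> S x \<Longrightarrow> b \<in> S y \<Longrightarrow> \<exists>e\<in>S (x + y). e \<le> a + b"
    and scale: "\<And>x a c. a \<in> S x \<Longrightarrow> 0 \<le> c \<Longrightarrow> \<exists>e\<in>S (c *\<^sub>R x). e \<le> c * a"
  shows "sublinear (\<lambda>x. Inf (S x))"
  unfolding sublinear_def
proof (intro conjI allI impI)
  fix x y
  have "Inf (S (x + y)) - a \<le> b" if ab: "a \<in> S x" "b \<in> S y" for a b
  proof -
    obtain e where "e \<in> S (x + y)" "e \<le> a + b"
      using add[OF ab] by blast
    then show ?thesis
      using cInf_lower[OF _ bdd] by fastforce
  qed
  then have "Inf (S (x + y)) - a \<le> Inf (S y)" if "a \<in> S x" for a
    using that by (intro cInf_greatest ne)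
  then have "Inf (S (x + y)) - Inf (S y) \<le> a" if "a \<in> S x" for a
    using that by fastforce
  then have "Inf (S (x + y)) - Inf (S y) \<le> Inf (S x)"
    by (intro cInf_greatest ne)
  then show "Inf (S (x + y)) \<le> Inf (S x) + Inf (S y)"
    by simp
next
  fix c :: real and x
  assume c: "0 \<le> c"
  have *: "Inf (S (c *\<^sub>R x)) \<le> c * a" if a: "a \<in> S x" for a
  proof -
    obtain e where "e \<in> S (c *\<^sub>R x)" "e \<le> c * a"
      using scale[OF a c] by blast
    then show ?thesis
      using cInf_lower[OF _ bdd] by fastforce
  qed
  show "Inf (S (c *\<^sub>R x)) \<le> c * Inf (S x)"
  proof (cases "c = 0")
    case True
    then show ?thesis
      using * ne[of x] by force
  next
    case False
    then have "Inf (S (c *\<^sub>R x)) / c \<le> Inf (S x)"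
      using * c by (intro cInf_greatest ne) (simp add: field_simps)
    then show ?thesis
      using False c by (simp add: field_simps)
  qed
qed

text \<open>The step that makes minimal functionals linear. Minimizing \<open>q (x + t y) - t q y\<close> over
  \<open>t \<ge> 0\<close> gives a sublinear functional below \<open>q\<close> (take \<open>t = 0\<close>), and \<open>t = 1\<close> shows that its value
  at \<open>- y\<close> is at most \<open>- q y\<close>.\<close>

lemma sublinear_descend:
  assumes q: "sublinear q"
  obtains q' where "sublinear q'" "q' \<le> q" "q' (- y) \<le> - q y"
proof
  define S where "S = (\<lambda>x. (\<lambda>t. q (x + t *\<^sub>R y) - t * q y) ` {0..})"
  have bdd: "bdd_below (S x)" for x
  proof (rule bdd_belowI[where m = "- q (- x)"])
    fix s assume "s \<in> S x"
    then obtain t where t: "t \<ge> 0" and s: "s = q (x + t *\<^sub>R y) - t * q y"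
      by (auto simp: S_def)
    have "t * q y \<le> q (x + t *\<^sub>R y) + q (- x)"
      using sublinear_add[OF q, of "x + t *\<^sub>R y" "- x"] sublinear_scaleR[OF q t, of y] by simp
    then show "- q (- x) \<le> s"
      using s by simp
  qed
  show "sublinear (\<lambda>x. Inf (S x))"
  proof (rule sublinear_Inf)
    show "S x \<noteq> {}" for x
      by (simp add: S_def)
  next
    fix x z a b
    assume "a \<in> S x" "b \<in> S z"
    then obtain s t where st: "s \<ge> 0" "t \<ge> 0" and ab: "a = q (x + s *\<^sub>R y) - s * q y"
        "b = q (z + t *\<^sub>R y) - t * q y"
      by (auto simp: S_def)
    have "q ((x + z) + (s + t) *\<^sub>R y) \<le> q (x + s *\<^sub>R y) + q (z + t *\<^sub>R y)"
      using sublinear_add[OF q, of "x + s *\<^sub>R y" "z + t *\<^sub>R y"] by (simp add: algebra_simps)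
    then show "\<exists>e\<in>S (x + z). e \<le> a + b"
      unfolding S_def using st by (intro bexI[OF _ imageI[of "s + t"]]) (auto simp: ab algebra_simps)
  next
    fix x a and c :: real
    assume "a \<in> S x" and c: "0 \<le> c"
    then obtain s where s: "s \<ge> 0" "a = q (x + s *\<^sub>R y) - s * q y"
      by (auto simp: S_def)
    have "q (c *\<^sub>R x + (c * s) *\<^sub>R y) = c * q (x + s *\<^sub>R y)"
      using sublinear_scaleR[OF q c, of "x + s *\<^sub>R y"] by (simp add: algebra_simps)
    then have "q (c *\<^sub>R x + (c * s) *\<^sub>R y) - c * s * q y = c * a"
      by (simp only: s(2) right_diff_distrib mult.assoc)
    then show "\<exists>e\<in>S (c *\<^sub>R x). e \<le> c * a"
      unfolding S_def using s c
      by (intro bexI[OF _ imageI[of "c * s"]]) auto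
  qed (rule bdd)
  show "(\<lambda>x. Inf (S x)) \<le> q"
  proof (rule le_funI)
    fix x
    have "q x \<in> S x"
      unfolding S_def by (rule image_eqI[of _ _ 0]) auto
    then show "Inf (S x) \<le> q x"
      using bdd by (rule cInf_lower)
  qed
  have "- q y \<in> S (- y)"
    unfolding S_def by (rule image_eqI[of _ _ 1]) (auto simp: sublinear_0[OF q])
  then show "Inf (S (- y)) \<le> - q y"
    using bdd by (rule cInf_lower)
qed

text \<open>Zorn's lemma for the reversed pointwise order: the pointwise infimum of a chain stays sublinear,
  because two members of a chain can be replaced by the smaller one, and it is finite because
  every \<open>q \<le> p\<close> satisfies \<open>q x \<ge> - q (- x) \<ge> - p (- x)\<close>.\<close>

lemma minimal_sublinear_exists:
  assumes p: "sublinear p"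
  obtains m where "sublinear m" "m \<le> p" "\<And>q. sublinear q \<Longrightarrow> q \<le> m \<Longrightarrow> q = m"
proof -
  define Q where "Q = {q. sublinear q \<and> q \<le> p}"
  have "\<exists>m\<in>Q. \<forall>q\<in>Q. m \<ge> q \<longrightarrow> q = m"
  proof (rule predicate_Zorn)
    show "partial_order_on Q (relation_of (\<ge>) Q)"
      by (rule partial_order_on_relation_ofI) auto
  next
    fix C
    assume "C \<in> Chains (relation_of (\<ge>) Q)"
    then have CQ: "C \<subseteq> Q" and chain: "\<And>q r. q \<in> C \<Longrightarrow> r \<in> C \<Longrightarrow> q \<le> r \<or> r \<le> q"
      by (auto simp: Chains_def relation_of_def)
    show "\<exists>u\<in>Q. \<forall>q\<in>C. q \<ge> u"
    proof (cases "C = {}")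
      case True
      then show ?thesis
        using p by (auto simp: Q_def)
    next
      case False
      define S where "S = (\<lambda>x. (\<lambda>q. q x) ` C)"
      have bdd: "bdd_below (S x)" for x
      proof (rule bdd_belowI[where m = "- p (- x)"])
        fix s assume "s \<in> S x"
        then obtain q where "q \<in> C" and s: "s = q x"
          by (auto simp: S_def)
        then have "sublinear q" "q (- x) \<le> p (- x)"
          using CQ by (auto simp: Q_def le_fun_def)
        then show "- p (- x) \<le> s"
          using sublinear_minus[of q x] s by simp
      qed
      have sub: "sublinear (\<lambda>x. Inf (S x))"
      proof (rule sublinear_Inf)
        show "S x \<noteq> {}" for x
          using False by (simp add: S_def)
      next
        fix x y a b
        assume "a \<in> S x" "b \<in> S y"
        then obtain q r where qr: "q \<in> C" "r \<in> C" "a = q x" "b = r y"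
          by (auto simp: S_def)
        then obtain k where k: "k \<in> C" "k \<le> q" "k \<le> r"
          using chain[of q r] by auto
        have "k (x + y) \<le> k x + k y"
          using k(1) CQ by (auto simp: Q_def intro: sublinear_add)
        also have "\<dots> \<le> a + b"
          using k(2,3) qr(3,4) by (auto simp: le_fun_def intro: add_mono)
        finally show "\<exists>e\<in>S (x + y). e \<le> a + b"
          using k(1) by (auto simp: S_def)
      next
        fix x a and c :: real
        assume "a \<in> S x" "0 \<le> c"
        then show "\<exists>e\<in>S (c *\<^sub>R x). e \<le> c * a"
          using CQ by (auto simp: S_def Q_def intro: sublinear_scaleR_le)
      qed (rule bdd)
      have below: "(\<lambda>x. Inf (S x)) \<le> q" if "q \<in> C" for q
        using that by (intro le_funI cInf_lower bdd) (auto simp: S_def)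
      obtain q where "q \<in> C"
        using False by blast
      then have "(\<lambda>x. Inf (S x)) \<le> p"
        using below[of q] CQ by (auto simp: Q_def intro: order_trans)
      then show ?thesis
        using sub below by (intro bexI[of _ "\<lambda>x. Inf (S x)"]) (auto simp: Q_def)
    qed
  qed
  then obtain m where m: "m \<in> Q" "\<And>q. q \<in> Q \<Longrightarrow> q \<le> m \<Longrightarrow> q = m"
    by blast
  show thesis
  proof (rule that[of m])
    show "q = m" if "sublinear q" "q \<le> m" for q
      using that m(1) by (intro m(2)) (auto simp: Q_def intro: order_trans)
  qed (use m(1) in \<open>auto simp: Q_def\<close>)
qed

text \<open>A minimal sublinear functional is odd by \<open>sublinear_descend\<close>, and an odd sublinear functional is
  linear. Descending once at \<open>y\<close> before minimizing forces the value at \<open>y\<close> to be \<open>p y\<close>.\<close>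

theorem Hahn_Banach_sublinear:
  assumes p: "sublinear p"
  obtains f where "linear f" "\<And>x. f x \<le> p x" "f y = p y"
proof -
  obtain p' where p': "sublinear p'" "p' \<le> p" "p' (- y) \<le> - p y"
    using sublinear_descend[OF p] by blast
  obtain m where m: "sublinear m" "m \<le> p'" and min: "\<And>q. sublinear q \<Longrightarrow> q \<le> m \<Longrightarrow> q = m"
    using minimal_sublinear_exists[OF p'(1)] by blast
  have odd: "m (- x) = - m x" for x
  proof -
    obtain q where "sublinear q" "q \<le> m" "q (- x) \<le> - m x"
      using sublinear_descend[OF m(1)] by blast
    then have "m (- x) \<le> - m x"
      using min by auto
    then show ?thesis
      using sublinear_minus[OF m(1), of x] by simp
  qed
  have add: "m (x + z) = m x + m z" for x z
    using sublinear_add[OF m(1), of x z] sublinear_add[OF m(1), of "- x" "- z"]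
      odd[of x] odd[of z] odd[of "x + z"] by simp
  have "linear m"
  proof (rule linearI)
    fix c :: real and x
    show "m (c *\<^sub>R x) = c *\<^sub>R m x"
    proof (cases "0 \<le> c")
      case True
      then show ?thesis
        using sublinear_scaleR[OF m(1)] by simp
    next
      case False
      then have "m ((- c) *\<^sub>R x) = - c * m x"
        using sublinear_scaleR[OF m(1), of "- c" x] by simp
      then show ?thesis
        using odd[of "c *\<^sub>R x"] by simp
    qed
  qed (rule add)
  moreover have le: "m x \<le> p x" for x
    using m(2) p'(2) by (meson le_funD order_trans)
  moreover have "m (- y) \<le> - p y"
    using m(2) p'(3) by (meson le_funD order_trans)
  then have "m y = p y"
    using odd[of y] le[of y] by simp
  ultimately show thesis
    by (rule that)
qed

section \<open>Bounded functionals and operators\<close>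

lemma bounded_clinear_cblinfun: "bounded_clinear (cblinfun_apply f)"
  using cblinfun_apply[of f] by simp

lemma bounded_linear_cblinfun: "bounded_linear (cblinfun_apply f)"
  using bounded_clinear_cblinfun[of f] by (simp add: bounded_clinear_def)

lemma cblinfun_scaleC: "cblinfun_apply f (c *\<^sub>C x) = c *\<^sub>C f x"
  using bounded_clinear_cblinfun[of f] by (simp add: bounded_clinear_def)

lemma norm_cblinfun_le: "norm (cblinfun_apply f x) \<le> norm f * norm x"
  by (simp add: norm_cblinfun.rep_eq onorm bounded_linear_cblinfun)

lemma norm_cblinfun_le_unit: "norm x \<le> 1 \<Longrightarrow> norm (cblinfun_apply f x) \<le> norm f"
  using norm_cblinfun_le[of f x] mult_left_le[of "norm x" "norm f"] by simp

lemma norm_cblinfun_boundI: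
  "0 \<le> b \<Longrightarrow> (\<And>x. norm (cblinfun_apply f x) \<le> b * norm x) \<Longrightarrow> norm f \<le> b"
  by (simp add: norm_cblinfun.rep_eq onorm_bound)

lemma cblinfun_almost_attains_norm:
  assumes "e < norm f"
  obtains x where "norm x \<le> 1" "e < norm (cblinfun_apply f x)"
proof (cases "0 \<le> e")
  case False
  then show ?thesis
    using that[of 0] by (smt (verit) norm_ge_zero norm_zero)
next
  case True
  have "\<exists>x. norm x \<le> 1 \<and> e < norm (f x)"
  proof (rule ccontr)
    assume "\<not> ?thesis"
    then have le: "\<And>x. norm x \<le> 1 \<Longrightarrow> norm (f x) \<le> e"
      by (auto simp: not_less)
    have "norm (f x) \<le> e * norm x" for x
    proof (cases "x = 0")
      case True
      then show ?thesis
        by (simp add: linear_0[OF bounded_linear.linear[OF bounded_linear_cblinfun]])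
    next
      case False
      then have "norm (f (inverse (norm x) *\<^sub>R x)) \<le> e"
        by (intro le) simp
      then have "inverse (norm x) * norm (f x) \<le> e"
        by (simp add: linear_scale[OF bounded_linear.linear[OF bounded_linear_cblinfun]])
      then show ?thesis
        using False by (simp add: field_simps)
    qed
    then have "norm f \<le> e"
      using True by (intro norm_cblinfun_boundI)
    then show False
      using assms by simp
  qed
  then show ?thesis
    using that by blast
qed

lemma scaleC_minus_left: "(- c) *\<^sub>C x = - (c *\<^sub>C (x::'a::complex_normed_vector))"
  using scaleC_scaleC[of "-1" c x] scaleC_complex_of_real[of "-1" "c *\<^sub>C x"] by simp

lemma scaleC_scaleR_left: "(r *\<^sub>R c) *\<^sub>C x = r *\<^sub>R c *\<^sub>C (x::'a::complex_normed_vector)"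
  by (simp add: scaleR_conv_of_real scaleC_scaleC flip: scaleC_complex_of_real[of r "c *\<^sub>C x"])

lemma bounded_bilinear_scaleC:
  "bounded_bilinear ((*\<^sub>C) :: complex \<Rightarrow> 'a \<Rightarrow> 'a::complex_normed_vector)"
proof (rule bounded_bilinear.intro)
  show "\<exists>K. \<forall>c x. norm (c *\<^sub>C (x::'a)) \<le> norm c * norm x * K"
    by (rule exI[of _ 1]) (simp add: norm_scaleC)
qed (simp_all add: scaleC_add_left scaleC_add_right scaleC_scaleR_left scaleC_scaleR_commute)

lemmas tendsto_scaleC [tendsto_intros] = bounded_bilinear.tendsto[OF bounded_bilinear_scaleC]

text \<open>The complex functional with real part \<open>f\<close> is \<open>x \<mapsto> f x - \<i> f (\<i> x)\<close>. It is bounded because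
  a rotation of \<open>x\<close> makes its value real, where \<open>f\<close> controls it.\<close>

lemma complexify_real_functional:
  fixes f :: "'a::complex_normed_vector \<Rightarrow> real"
  assumes lin: "linear f" and le: "\<And>x. f x \<le> C * norm x"
  obtains F :: "'a \<Rightarrow>\<^sub>C\<^sub>L complex" where "\<And>x. Re (F x) = f x"
proof -
  define F where "F x = Complex (f x) (- f (\<i> *\<^sub>C x))" for x
  have scaleC: "F (c *\<^sub>C x) = c * F x" for c x
  proof -
    have expand: "d *\<^sub>C x = Re d *\<^sub>R x + Im d *\<^sub>R \<i> *\<^sub>C x" for d
    proof -
      have "d = complex_of_real (Re d) + complex_of_real (Im d) * \<i>"
        by (simp add: complex_eq_iff)
      then have "d *\<^sub>C x = (complex_of_real (Re d) + complex_of_real (Im d) * \<i>) *\<^sub>C x"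
        by simp
      then show ?thesis
        by (simp add: scaleC_add_left scaleC_complex_of_real flip: scaleC_scaleC)
    qed
    have f: "f (d *\<^sub>C x) = Re d * f x + Im d * f (\<i> *\<^sub>C x)" for d
      by (simp add: expand[of d] linear_add[OF lin] linear_scale[OF lin])
    show ?thesis
      using f[of c] f[of "\<i> * c"] by (simp add: F_def scaleC_scaleC complex_eq_iff)
  qed
  have le': "norm (F x) \<le> C * norm x" for x
  proof (cases "F x = 0")
    case True
    have "0 \<le> C * norm x"
      using le[of x] le[of "- x"] linear_neg[OF lin, of x] by simp
    then show ?thesis
      using True by simp
  next
    case False
    \<comment> \<open>the unimodular factor that turns \<open>F x\<close> into its absolute value\<close>
    define c where "c = cnj (F x) / cmod (F x)"
    have "norm (F x) = Re (c * F x)"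
      using False by (simp add: c_def complex_norm_square[symmetric] power2_eq_square
          mult.commute[of "cnj _"] del: of_real_mult flip: of_real_mult)
    also have "\<dots> = f (c *\<^sub>C x)"
      unfolding scaleC[symmetric] by (simp add: F_def)
    also have "\<dots> \<le> C * (cmod c * norm x)"
      using le[of "c *\<^sub>C x"] by (simp add: norm_scaleC)
    also have "cmod c = 1"
      using False by (simp add: c_def norm_divide)
    finally show ?thesis
      by simp
  qed
  have "bounded_linear F"
  proof (rule bounded_linear_intro[where K = C])
    show "F (x + y) = F x + F y" for x y
      by (simp add: F_def complex_eq_iff scaleC_add_right linear_add[OF lin])
    show "F (r *\<^sub>R x) = r *\<^sub>R F x" for r x
      by (simp add: F_def complex_eq_iff scaleC_scaleR_commute linear_scale[OF lin])
    show "norm (F x) \<le> norm x * C" for x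
      using le'[of x] by (simp add: mult.commute)
  qed
  then have "bounded_clinear F"
    by (simp add: bounded_clinear_def scaleC scaleC_complex_def)
  then show thesis
    using that[of "CBlinfun F"] by (simp add: CBlinfun_inverse F_def)
qed

lemma norming_functional:
  fixes x :: "'a::complex_normed_vector"
  obtains F :: "'a \<Rightarrow>\<^sub>C\<^sub>L complex" where "\<And>y. Re (F y) \<le> norm y" "Re (F x) = norm x"
proof -
  have "sublinear (norm :: 'a \<Rightarrow> real)"
    by (simp add: sublinear_def norm_triangle_ineq)
  then obtain f where f: "linear f" "\<And>y. f y \<le> norm y" "f x = norm x"
    using Hahn_Banach_sublinear by blast
  obtain F :: "'a \<Rightarrow>\<^sub>C\<^sub>L complex" where "\<And>y. Re (F y) = f y"
    using complexify_real_functional[OF f(1), of 1] f(2) by auto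
  then show thesis
    by (intro that[of F]) (simp_all add: f)
qed

section \<open>Compactness of the unit ball of a reflexive space as seen by compact operators\<close>

text \<open>A weak cluster point, in the form needed here: \<open>z\<close> lies in every closed half space
  that eventually contains the sequence. The infimum of the eventual upper bounds of
  \<open>Re (f (x n))\<close> is their upper limit; it is sublinear in \<open>f\<close> and bounded by the norm of \<open>f\<close>, so
  a linear functional below it is an element of the bidual.\<close>

lemma reflexive_weak_cluster_point:
  fixes x :: "nat \<Rightarrow> 'a::complex_normed_vector"
  assumes refl: "reflexive_space TYPE('a)" and x: "\<And>n. norm (x n) \<le> 1"
  obtains z where "\<And>(f :: 'a \<Rightarrow>\<^sub>C\<^sub>L complex) c. \<forall>\<^sub>F n in sequentially. Re (f (x n)) \<le> c \<Longrightarrow> Re (f z) \<le> c"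
proof -
  define S where "S = (\<lambda>f :: 'a \<Rightarrow>\<^sub>C\<^sub>L complex. {c. \<forall>\<^sub>F n in sequentially. Re (f (x n)) \<le> c})"
  have abs_le: "\<bar>Re (f (x n))\<bar> \<le> norm f" for f :: "'a \<Rightarrow>\<^sub>C\<^sub>L complex" and n
    using abs_Re_le_cmod[of "f (x n)"] norm_cblinfun_le_unit[OF x, of f n] by simp
  have norm_S: "norm f \<in> S f" for f
    unfolding S_def using abs_le[of f] by (auto simp: abs_le_iff)
  have bdd: "bdd_below (S f)" for f
  proof (rule bdd_belowI[where m = "- norm f"])
    fix c assume "c \<in> S f"
    then obtain n where "Re (f (x n)) \<le> c"
      unfolding S_def by (auto simp: eventually_sequentially)
    then show "- norm f \<le> c"
      using abs_le[of f n] by simp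
  qed
  have "sublinear (\<lambda>f. Inf (S f))"
  proof (rule sublinear_Inf)
    show "S f \<noteq> {}" for f
      using norm_S by blast
  next
    fix f g a b
    assume "a \<in> S f" "b \<in> S g"
    then have "a + b \<in> S (f + g)"
      unfolding S_def by (auto simp: plus_cblinfun.rep_eq elim: eventually_elim2 intro: add_mono)
    then show "\<exists>e\<in>S (f + g). e \<le> a + b"
      by blast
  next
    fix f a and c :: real
    assume "a \<in> S f" "0 \<le> c"
    then have "c * a \<in> S (c *\<^sub>R f)"
      unfolding S_def by (auto simp: scaleR_cblinfun.rep_eq elim!: eventually_mono intro: mult_left_mono)
    then show "\<exists>e\<in>S (c *\<^sub>R f). e \<le> c * a"
      by blast
  qed (rule bdd)
  then obtain F where F: "linear F" "\<And>f. F f \<le> Inf (S f)"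
    using Hahn_Banach_sublinear by blast
  have "F f \<le> 1 * norm f" for f
    using F(2)[of f] cInf_lower[OF norm_S bdd, of f] by simp
  then obtain G :: "('a \<Rightarrow>\<^sub>C\<^sub>L complex) \<Rightarrow>\<^sub>C\<^sub>L complex" where G: "\<And>f. Re (G f) = F f"
    using complexify_real_functional[OF F(1)] by blast
  obtain z where z: "G = bidual_embedding z"
    using refl unfolding reflexive_space_def by (auto elim: surjE)
  show thesis
  proof (rule that[of z])
    fix f :: "'a \<Rightarrow>\<^sub>C\<^sub>L complex" and c
    assume "\<forall>\<^sub>F n in sequentially. Re (f (x n)) \<le> c"
    then have "Inf (S f) \<le> c"
      by (intro cInf_lower bdd) (simp add: S_def)
    then show "Re (f z) \<le> c"
      using F(2)[of f] G[of f] by (simp add: z bidual_embedding.rep_eq)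
  qed
qed

text \<open>A norm limit of the images must be the image of the weak cluster point: pull a functional norming
  \<open>T z - u\<close> back along \<open>T\<close> and test \<open>z\<close> against it.\<close>

lemma weak_cluster_image_eq_limit:
  fixes T :: "'a::complex_normed_vector \<Rightarrow>\<^sub>C\<^sub>L 'b::complex_normed_vector"
  assumes z: "\<And>(f :: 'a \<Rightarrow>\<^sub>C\<^sub>L complex) c. \<forall>\<^sub>F n in sequentially. Re (f (x n)) \<le> c \<Longrightarrow> Re (f z) \<le> c"
    and lim: "(\<lambda>n. T (x n)) \<longlonglongrightarrow> u"
  shows "T z = u"
proof -
  obtain g :: "'b \<Rightarrow>\<^sub>C\<^sub>L complex" where g: "Re (g (T z - u)) = norm (T z - u)"
    by (rule norming_functional)
  define f where "f = CBlinfun (\<lambda>x. g (T x))"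
  have "bounded_clinear (\<lambda>x. g (T x))"
    by (simp add: bounded_clinear_def cblinfun_scaleC
        bounded_linear_compose[OF bounded_linear_cblinfun bounded_linear_cblinfun])
  then have f: "f y = g (T y)" for y
    by (simp add: f_def CBlinfun_inverse)
  have "(\<lambda>n. Re (f (x n))) \<longlonglongrightarrow> Re (g u)"
    unfolding f by (intro tendsto_intros bounded_linear.tendsto[OF bounded_linear_cblinfun] lim)
  then have "\<forall>\<^sub>F n in sequentially. Re (f (x n)) < Re (g u) + e" if "e > 0" for e
    using that by (intro order_tendstoD(2)[where y = "Re (g u)"]) simp_all
  then have "Re (f z) \<le> Re (g u) + e" if "e > 0" for e
    using that by (intro z) (blast intro: eventually_mono less_imp_le)
  then have "Re (f z) \<le> Re (g u)"
    by (rule field_le_epsilon)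
  moreover have "norm (T z - u) = Re (f z) - Re (g u)"
    using g by (simp add: f linear_diff[OF bounded_linear.linear[OF bounded_linear_cblinfun]])
  ultimately have "norm (T z - u) \<le> 0"
    by simp
  then show ?thesis
    by simp
qed

lemma weak_cluster_norm_le:
  fixes x :: "nat \<Rightarrow> 'a::complex_normed_vector"
  assumes z: "\<And>(f :: 'a \<Rightarrow>\<^sub>C\<^sub>L complex) c. \<forall>\<^sub>F n in sequentially. Re (f (x n)) \<le> c \<Longrightarrow> Re (f z) \<le> c"
    and x: "\<And>n. norm (x n) \<le> b"
  shows "norm z \<le> b"
proof -
  obtain f :: "'a \<Rightarrow>\<^sub>C\<^sub>L complex" where f: "\<And>y. Re (f y) \<le> norm y" "Re (f z) = norm z"
    by (rule norming_functional[of z]) blast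
  have "Re (f z) \<le> b"
    using order_trans[OF f(1) x] by (intro z always_eventually) blast
  then show ?thesis
    using f(2) by simp
qed

lemma compact_operator_subseq:
  fixes x :: "nat \<Rightarrow> 'a::complex_normed_vector"
  assumes "T \<in> compact_operators" and x: "\<And>n. norm (x n) \<le> 1"
  obtains r u where "strict_mono r" "(\<lambda>n. cblinfun_apply T (x (r n))) \<longlonglongrightarrow> u"
proof -
  have "seq_compact (closure (cblinfun_apply T ` cball 0 1))"
    using assms(1) by (simp add: compact_operators_def compact_imp_seq_compact)
  moreover have "\<forall>n. T (x n) \<in> closure (cblinfun_apply T ` cball 0 1)"
    using x by (auto intro!: subsetD[OF closure_subset])
  ultimately obtain u r where "strict_mono r" "((\<lambda>n. T (x n)) \<circ> r) \<longlonglongrightarrow> u"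
    using seq_compactE[where f = "\<lambda>n. T (x n)"] by blast
  then show thesis
    using that by (simp add: o_def)
qed

lemma compact_operators_subseq_limit:
  fixes T A :: "'a::complex_normed_vector \<Rightarrow>\<^sub>C\<^sub>L 'b::complex_normed_vector"
    and x :: "nat \<Rightarrow> 'a"
  assumes refl: "reflexive_space TYPE('a)"
    and T: "T \<in> compact_operators" and A: "A \<in> compact_operators"
    and x: "\<And>n. norm (x n) \<le> 1"
  obtains r z where "strict_mono r" "norm z \<le> 1"
    "(\<lambda>n. T (x (r n))) \<longlonglongrightarrow> T z" "(\<lambda>n. A (x (r n))) \<longlonglongrightarrow> A z"
proof -
  obtain r u where r: "strict_mono r" and u: "(\<lambda>n. T (x (r n))) \<longlonglongrightarrow> u"
    by (rule compact_operator_subseq[OF T, where x = x]) (rule x)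
  obtain s v where s: "strict_mono s" and v: "(\<lambda>n. A (x (r (s n)))) \<longlonglongrightarrow> v"
    by (rule compact_operator_subseq[OF A, where x = "\<lambda>n. x (r n)"]) (rule x)
  have u': "(\<lambda>n. T (x (r (s n)))) \<longlonglongrightarrow> u"
    using LIMSEQ_subseq_LIMSEQ[OF u s] by (simp add: o_def)
  obtain z where z: "\<And>(f :: 'a \<Rightarrow>\<^sub>C\<^sub>L complex) c.
      \<forall>\<^sub>F n in sequentially. Re (f (x (r (s n)))) \<le> c \<Longrightarrow> Re (f z) \<le> c"
    by (rule reflexive_weak_cluster_point[OF refl, where x = "\<lambda>n. x (r (s n))"]) (rule x, blast)
  have "norm z \<le> 1"
    by (rule weak_cluster_norm_le[OF z x])
  moreover have "T z = u" "A z = v"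
    by (rule weak_cluster_image_eq_limit[OF z u'], assumption)
      (rule weak_cluster_image_eq_limit[OF z v], assumption)
  ultimately show thesis
    using that[of "\<lambda>n. r (s n)" z] strict_mono_o[OF r s] u' v by (simp add: o_def)
qed

section \<open>The directions in which a vector does not shrink\<close>

lemma mem_plus_set_limit:
  assumes u: "u \<longlonglongrightarrow> u'" and v: "v \<longlonglongrightarrow> v'" and a: "a \<longlonglongrightarrow> a'"
    and mem: "\<And>n. v n \<in> plus_set (a n) (u n)"
  shows "v' \<in> plus_set a' u'"
  unfolding plus_set_def
proof (intro CollectI allI impI)
  fix t :: real
  assume "0 \<le> t"
  then have "norm (u n) \<le> norm (u n + (complex_of_real t * a n) *\<^sub>C v n)" for n
    using mem[of n] by (simp add: plus_set_def)
  moreover have "(\<lambda>n. norm (u n + (complex_of_real t * a n) *\<^sub>C v n))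
      \<longlonglongrightarrow> norm (u' + (complex_of_real t * a') *\<^sub>C v')"
    by (intro tendsto_intros u v a)
  ultimately show "norm u' \<le> norm (u' + (complex_of_real t * a') *\<^sub>C v')"
    using tendsto_norm[OF u] by (intro LIMSEQ_le) auto
qed

text \<open>If \<open>u\<close> shrank at \<open>r e\<^sup>i\<^sup>\<theta>\<close> and at \<open>s e\<^sup>i\<^sup>\<psi>\<close> with \<open>\<theta> < \<phi> < \<psi>\<close>, then it would shrink on
  the whole segment between these points by convexity. As \<open>\<psi> - \<theta> \<le> \<pi>\<close>, that segment
  meets the ray at angle \<open>\<phi>\<close>, possibly at the origin.\<close>

lemma plus_set_sector:
  assumes mem: "v \<in> plus_set (cis \<phi>) u" and \<phi>: "0 \<le> \<phi>" "\<phi> \<le> pi"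
  shows "(\<forall>\<theta>\<in>{0..\<phi>}. v \<in> plus_set (cis \<theta>) u) \<or> (\<forall>\<theta>\<in>{\<phi>..pi}. v \<in> plus_set (cis \<theta>) u)"
proof (rule ccontr)
  assume "\<not> ?thesis"
  then obtain \<theta> \<psi> where \<theta>: "0 \<le> \<theta>" "\<theta> \<le> \<phi>" "v \<notin> plus_set (cis \<theta>) u"
    and \<psi>: "\<phi> \<le> \<psi>" "\<psi> \<le> pi" "v \<notin> plus_set (cis \<psi>) u"
    by auto
  have "\<theta> < \<phi>" "\<phi> < \<psi>"
    using mem \<theta> \<psi> by (auto simp: order.order_iff_strict)
  obtain r where r: "0 \<le> r" "norm (u + (complex_of_real r * cis \<theta>) *\<^sub>C v) < norm u"
    using \<theta>(3) by (auto simp: plus_set_def not_le)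
  obtain s where s: "0 \<le> s" "norm (u + (complex_of_real s * cis \<psi>) *\<^sub>C v) < norm u"
    using \<psi>(3) by (auto simp: plus_set_def not_le)
  \<comment> \<open>\<open>a\<close> and \<open>b\<close> are, up to normalization, the barycentric weights of the point where the segment
    meets the ray at angle \<open>\<phi>\<close>; its distance to the origin is \<open>t\<close>.\<close>
  define a where "a = s * sin (\<psi> - \<phi>)"
  define b where "b = r * sin (\<phi> - \<theta>)"
  have sin_pos: "0 < sin (\<psi> - \<phi>)" "0 < sin (\<phi> - \<theta>)"
    using \<open>\<theta> < \<phi>\<close> \<open>\<phi> < \<psi>\<close> \<theta>(1) \<psi>(2) by (auto intro: sin_gt_zero)
  have "r \<noteq> 0" "s \<noteq> 0"
    using r(2) s(2) scaleC_complex_of_real[of 0 v] by auto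
  then have ab: "0 < a" "0 < b"
    using sin_pos r(1) s(1) by (auto simp: a_def b_def)
  define t where "t = r * s * sin (\<psi> - \<theta>) / (a + b)"
  have t: "0 \<le> t"
    using ab r(1) s(1) \<theta>(1,2) \<psi>(1,2) by (auto simp: t_def intro!: divide_nonneg_pos mult_nonneg_nonneg sin_ge_zero)
  have comb: "complex_of_real a * (complex_of_real r * cis \<theta>) + complex_of_real b * (complex_of_real s * cis \<psi>)
      = complex_of_real (a + b) * (complex_of_real t * cis \<phi>)"
  proof -
    have "sin (\<psi> - \<phi>) * cos \<theta> + sin (\<phi> - \<theta>) * cos \<psi> = sin (\<psi> - \<theta>) * cos \<phi>"
         "sin (\<psi> - \<phi>) * sin \<theta> + sin (\<phi> - \<theta>) * sin \<psi> = sin (\<psi> - \<theta>) * sin \<phi>"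
      unfolding sin_diff by (simp_all add: algebra_simps)
    then have c: "complex_of_real (sin (\<psi> - \<phi>)) * cis \<theta> + complex_of_real (sin (\<phi> - \<theta>)) * cis \<psi>
        = complex_of_real (sin (\<psi> - \<theta>)) * cis \<phi>"
      by (simp add: complex_eq_iff)
    have "complex_of_real (a + b) * (complex_of_real t * cis \<phi>)
        = complex_of_real ((a + b) * t) * cis \<phi>"
      by (simp only: of_real_mult mult.assoc)
    also have "(a + b) * t = r * s * sin (\<psi> - \<theta>)"
      using ab by (simp add: t_def)
    also have "complex_of_real (r * s * sin (\<psi> - \<theta>)) * cis \<phi>
        = complex_of_real (r * s) * (complex_of_real (sin (\<psi> - \<theta>)) * cis \<phi>)"
      by (simp only: of_real_mult mult.assoc)
    finally show ?thesis
      unfolding c[symmetric] by (simp add: a_def b_def algebra_simps)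
  qed
  have "(a + b) * norm u \<le> (a + b) * norm (u + (complex_of_real t * cis \<phi>) *\<^sub>C v)"
    using mem t ab by (auto simp: plus_set_def)
  also have "\<dots> = norm ((a + b) *\<^sub>R (u + (complex_of_real t * cis \<phi>) *\<^sub>C v))"
    using ab by simp
  also have "(a + b) *\<^sub>R (u + (complex_of_real t * cis \<phi>) *\<^sub>C v)
      = (a + b) *\<^sub>R u + (complex_of_real (a + b) * (complex_of_real t * cis \<phi>)) *\<^sub>C v"
    by (simp only: scaleR_right_distrib scaleC_scaleC scaleC_complex_of_real flip: scaleC_complex_of_real[of "a + b" "_ *\<^sub>C v"])
  also have "\<dots> = a *\<^sub>R (u + (complex_of_real r * cis \<theta>) *\<^sub>C v) + b *\<^sub>R (u + (complex_of_real s * cis \<psi>) *\<^sub>C v)"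
    unfolding comb[symmetric]
    by (simp add: scaleC_add_left scaleC_scaleC[symmetric] scaleC_complex_of_real scaleC_scaleR_commute algebra_simps)
  also have "norm \<dots> \<le> a * norm (u + (complex_of_real r * cis \<theta>) *\<^sub>C v) + b * norm (u + (complex_of_real s * cis \<psi>) *\<^sub>C v)"
    using ab by (intro norm_triangle_le) simp
  also have "\<dots> < a * norm u + b * norm u"
    using ab r(2) s(2) by (intro add_strict_mono mult_strict_left_mono)
  finally show False
    by (simp add: algebra_simps)
qed

text \<open>Choose unit ball vectors whose images under \<open>T + e\<^sub>n \<alpha> A\<close> have norm greater than
  \<open>\<parallel>T\<parallel> - e\<^sub>n\<^sup>2\<close>. The point \<open>e\<^sub>n\<close> lies between \<open>0\<close>, where the norm is at most \<open>\<parallel>T\<parallel>\<close>, and a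
  fixed \<open>t > 0\<close>, so convexity bounds the norm at \<open>t\<close> below by \<open>\<parallel>T\<parallel> - t e\<^sub>n\<close>. The
  tolerance has to be of smaller order than \<open>e\<^sub>n\<close> because convexity amplifies it by \<open>t / e\<^sub>n\<close>.\<close>

lemma bj_orthogonal_attains_direction:
  fixes T A :: "'a::complex_normed_vector \<Rightarrow>\<^sub>C\<^sub>L 'b::complex_normed_vector"
  assumes refl: "reflexive_space TYPE('a)"
    and T: "T \<in> compact_operators" and A: "A \<in> compact_operators"
    and orth: "T \<bottom>\<^sub>B A"
  obtains z where "norm z \<le> 1" "norm (T z) = norm T" "A z \<in> plus_set \<alpha> (T z)"
proof -
  define e where "e n = 1 / real (Suc n)" for n
  have e: "0 < e n" for n
    by (simp add: e_def)
  have e_lim: "e \<longlonglongrightarrow> 0"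
    using LIMSEQ_inverse_real_of_nat unfolding e_def by (simp add: inverse_eq_divide)
  have "\<exists>x. norm x \<le> 1 \<and> norm T - (e n)\<^sup>2 < norm (T x + (complex_of_real (e n) * \<alpha>) *\<^sub>C A x)" for n
  proof -
    have "norm T \<le> norm (T + (complex_of_real (e n) * \<alpha>) *\<^sub>C A)"
      using orth by (simp add: bj_orthogonal_def)
    then have "norm T - (e n)\<^sup>2 < norm (T + (complex_of_real (e n) * \<alpha>) *\<^sub>C A)"
      using e[of n] by (smt (verit) zero_less_power)
    then show ?thesis
      by (rule cblinfun_almost_attains_norm) (auto simp: plus_cblinfun.rep_eq scaleC_cblinfun.rep_eq)
  qed
  then obtain x where x: "\<And>n. norm (x n) \<le> 1"
    and almost: "\<And>n. norm T - (e n)\<^sup>2 < norm (T (x n) + (complex_of_real (e n) * \<alpha>) *\<^sub>C A (x n))"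
    by metis
  obtain r z where r: "strict_mono r" and z: "norm z \<le> 1"
    and Tz: "(\<lambda>n. T (x (r n))) \<longlonglongrightarrow> T z" and Az: "(\<lambda>n. A (x (r n))) \<longlonglongrightarrow> A z"
    by (rule compact_operators_subseq_limit[OF refl T A x])
  have er: "(\<lambda>n. e (r n)) \<longlonglongrightarrow> 0"
    using LIMSEQ_subseq_LIMSEQ[OF e_lim r] by (simp add: o_def)
  have Tx: "norm (T (x n)) \<le> norm T" for n
    by (rule norm_cblinfun_le_unit[OF x])
  have "norm T \<le> norm (T z)"
  proof (rule LIMSEQ_le)
    show "(\<lambda>n. norm T - (e (r n))\<^sup>2) \<longlonglongrightarrow> norm T"
      using er by (auto intro!: tendsto_eq_intros)
    show "(\<lambda>n. norm (T (x (r n)) + (complex_of_real (e (r n)) * \<alpha>) *\<^sub>C A (x (r n)))) \<longlonglongrightarrow> norm (T z)"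
      using scaleC_complex_of_real[of 0 "A z"] by (auto intro!: tendsto_eq_intros Tz Az er)
    show "\<exists>N. \<forall>n\<ge>N. norm T - (e (r n))\<^sup>2 \<le> norm (T (x (r n)) + (complex_of_real (e (r n)) * \<alpha>) *\<^sub>C A (x (r n)))"
      using almost less_imp_le by blast
  qed
  then have attain: "norm (T z) = norm T"
    using norm_cblinfun_le_unit[OF z, of T] by simp
  have "norm T \<le> norm (T z + (complex_of_real t * \<alpha>) *\<^sub>C A z)" if "0 \<le> t" for t
  proof (cases "t = 0")
    case True
    then show ?thesis
      using attain scaleC_complex_of_real[of 0 "A z"] by simp
  next
    case False
    then have t: "0 < t"
      using that by simp
    have bound: "norm T - t * e n \<le> norm (T (x n) + (complex_of_real t * \<alpha>) *\<^sub>C A (x n))"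
      if small: "e n < t" for n
    proof -
      let ?g = "\<lambda>s. T (x n) + (complex_of_real s * \<alpha>) *\<^sub>C A (x n)"
      have "t * norm (?g (e n)) = norm (t *\<^sub>R ?g (e n))"
        using t by simp
      also have "t *\<^sub>R ?g (e n) = (t - e n) *\<^sub>R T (x n) + e n *\<^sub>R ?g t"
        by (simp add: scaleC_complex_of_real scaleC_scaleR_commute algebra_simps flip: scaleC_scaleC)
      also have "norm \<dots> \<le> (t - e n) * norm (T (x n)) + e n * norm (?g t)"
        using small e[of n] by (intro norm_triangle_le) simp
      also have "\<dots> \<le> (t - e n) * norm T + e n * norm (?g t)"
        using small Tx[of n] by (intro add_right_mono mult_left_mono) simp_all
      finally have "t * norm (?g (e n)) \<le> (t - e n) * norm T + e n * norm (?g t)" .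
      moreover have "t * (norm T - (e n)\<^sup>2) \<le> t * norm (?g (e n))"
        using t almost[of n] by (intro mult_left_mono) simp_all
      ultimately have "e n * (norm T - t * e n) \<le> e n * norm (?g t)"
        by (simp add: algebra_simps power2_eq_square)
      then show ?thesis
        using e[of n] by simp
    qed
    show ?thesis
    proof (rule tendsto_le)
      show "\<forall>\<^sub>F n in sequentially. norm T - t * e (r n) \<le> norm (T (x (r n)) + (complex_of_real t * \<alpha>) *\<^sub>C A (x (r n)))"
        using order_tendstoD(2)[OF er t] by eventually_elim (rule bound)
      show "(\<lambda>n. norm (T (x (r n)) + (complex_of_real t * \<alpha>) *\<^sub>C A (x (r n))))
          \<longlonglongrightarrow> norm (T z + (complex_of_real t * \<alpha>) *\<^sub>C A z)"
        by (intro tendsto_intros Tz Az)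
      show "(\<lambda>n. norm T - t * e (r n)) \<longlonglongrightarrow> norm T"
        using er by (auto intro!: tendsto_eq_intros)
    qed simp
  qed
  then have "A z \<in> plus_set \<alpha> (T z)"
    using attain by (simp add: plus_set_def)
  then show thesis
    using that z attain by blast
qed

lemma norm_attain_setI:
  fixes T :: "'a::complex_normed_vector \<Rightarrow>\<^sub>C\<^sub>L 'b::complex_normed_vector"
  assumes "norm x \<le> 1" "norm (T x) = norm T" "T \<noteq> 0"
  shows "x \<in> norm_attain_set T"
proof -
  have "norm T * 1 \<le> norm T * norm x"
    using norm_cblinfun_le[of T x] assms(2) by simp
  then have "1 \<le> norm x"
    using mult_le_cancel_left_pos[of "norm T" 1 "norm x"] assms(3) by simp
  then show ?thesis
    using assms by (simp add: norm_attain_set_def)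
qed

text \<open>The function \<open>h\<close> stands for \<open>min\<close> or \<open>max\<close>: letting \<open>min \<theta> \<phi>\<close> range over \<open>\<theta> \<in> [0,\<pi>]\<close>
  sweeps out \<open>[0,\<phi>]\<close> with an index set that does not move with \<open>\<phi>\<close>, so that limits can be taken
  for each \<open>\<theta>\<close> separately.\<close>

lemma closed_attaining_directions:
  fixes T A :: "'a::complex_normed_vector \<Rightarrow>\<^sub>C\<^sub>L 'b::complex_normed_vector"
  assumes refl: "reflexive_space TYPE('a)"
    and T: "T \<in> compact_operators" and A: "A \<in> compact_operators" and "T \<noteq> 0"
    and h: "\<And>\<theta>. \<theta> \<in> I \<Longrightarrow> continuous_on UNIV (h \<theta>)"
  shows "closed {\<phi> :: real. \<exists>x\<in>norm_attain_set T. \<forall>\<theta>\<in>I. A x \<in> plus_set (cis (h \<theta> \<phi>)) (T x)}"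
  unfolding closed_sequential_limits
proof (intro allI impI, elim conjE)
  fix \<phi> l
  assume "\<forall>n. \<phi> n \<in> {\<phi>. \<exists>x\<in>norm_attain_set T. \<forall>\<theta>\<in>I. A x \<in> plus_set (cis (h \<theta> \<phi>)) (T x)}"
    and lim: "\<phi> \<longlonglongrightarrow> l"
  then have "\<forall>n. \<exists>x. x \<in> norm_attain_set T \<and> (\<forall>\<theta>\<in>I. A x \<in> plus_set (cis (h \<theta> (\<phi> n))) (T x))"
    by blast
  then obtain x where x: "\<And>n. x n \<in> norm_attain_set T"
    and mem: "\<And>n \<theta>. \<theta> \<in> I \<Longrightarrow> A (x n) \<in> plus_set (cis (h \<theta> (\<phi> n))) (T (x n))"
    by metis
  have x_le: "norm (x n) \<le> 1" for n
    using x[of n] by (simp add: norm_attain_set_def)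
  obtain r z where r: "strict_mono r" and z: "norm z \<le> 1"
    and Tz: "(\<lambda>n. T (x (r n))) \<longlonglongrightarrow> T z" and Az: "(\<lambda>n. A (x (r n))) \<longlonglongrightarrow> A z"
    by (rule compact_operators_subseq_limit[OF refl T A x_le])
  have "norm (T z) = norm T"
    using tendsto_norm[OF Tz] x by (simp add: norm_attain_set_def LIMSEQ_const_iff)
  then have "z \<in> norm_attain_set T"
    using z \<open>T \<noteq> 0\<close> by (intro norm_attain_setI)
  moreover have "A z \<in> plus_set (cis (h \<theta> l)) (T z)" if "\<theta> \<in> I" for \<theta>
  proof (rule mem_plus_set_limit[OF Tz Az])
    show "A (x (r n)) \<in> plus_set (cis (h \<theta> (\<phi> (r n)))) (T (x (r n)))" for n
      using that by (rule mem)
    have "isCont (h \<theta>) l"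
      using h[OF that] by (simp add: continuous_on_eq_continuous_at)
    moreover have "(\<lambda>n. \<phi> (r n)) \<longlonglongrightarrow> l"
      using LIMSEQ_subseq_LIMSEQ[OF lim r] by (simp add: o_def)
    ultimately have "(\<lambda>n. h \<theta> (\<phi> (r n))) \<longlonglongrightarrow> h \<theta> l"
      by (rule isCont_tendsto_compose)
    then show "(\<lambda>n. cis (h \<theta> (\<phi> (r n)))) \<longlonglongrightarrow> cis (h \<theta> l)"
      unfolding cis_conv_exp by (intro tendsto_intros)
  qed
  ultimately show "l \<in> {\<phi>. \<exists>x\<in>norm_attain_set T. \<forall>\<theta>\<in>I. A x \<in> plus_set (cis (h \<theta> \<phi>)) (T x)}"
    by blast
qed

text \<open>For \<open>T = 0\<close> every unit vector attains the norm and no direction shrinks the zero vector. Otherwise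
  the closed sets \<open>P\<close> and \<open>Q\<close> below cover the connected interval \<open>[0,\<pi>]\<close>, so they meet in it.\<close>

proposition bj_orthogonal_two_attaining_vectors:
  fixes T A :: "'a::complex_normed_vector \<Rightarrow>\<^sub>C\<^sub>L 'b::complex_normed_vector"
  assumes nonzero: "\<exists>x::'a. x \<noteq> 0" and refl: "reflexive_space TYPE('a)"
    and T: "T \<in> compact_operators" and A: "A \<in> compact_operators"
    and orth: "T \<bottom>\<^sub>B A"
  obtains x y \<phi> where "x \<in> norm_attain_set T" "y \<in> norm_attain_set T" "\<phi> \<in> {0..pi}"
    "\<forall>\<theta>\<in>{0..\<phi>}. A x \<in> plus_set (cis \<theta>) (T x)" "\<forall>\<theta>\<in>{\<phi>..pi}. A y \<in> plus_set (cis \<theta>) (T y)"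
proof (cases "T = 0")
  case True
  obtain x0 :: 'a where "x0 \<noteq> 0"
    using nonzero by blast
  then have "(1 / norm x0) *\<^sub>R x0 \<in> norm_attain_set T"
    by (simp add: norm_attain_set_def True zero_cblinfun.rep_eq)
  moreover have "A x \<in> plus_set \<alpha> (T x)" for x \<alpha>
    by (simp add: plus_set_def True zero_cblinfun.rep_eq)
  ultimately show ?thesis
    using that[of _ _ 0] by simp
next
  case False
  define P where "P = {\<phi>. \<exists>x\<in>norm_attain_set T. \<forall>\<theta>\<in>{0..pi}. A x \<in> plus_set (cis (min \<theta> \<phi>)) (T x)}"
  define Q where "Q = {\<phi>. \<exists>x\<in>norm_attain_set T. \<forall>\<theta>\<in>{0..pi}. A x \<in> plus_set (cis (max \<theta> \<phi>)) (T x)}"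
  have "closed P" "closed Q"
    unfolding P_def Q_def
    by (rule closed_attaining_directions[OF refl T A False]; intro continuous_intros)+
  have P_iff: "\<phi> \<in> P \<longleftrightarrow> (\<exists>x\<in>norm_attain_set T. \<forall>\<theta>\<in>{0..\<phi>}. A x \<in> plus_set (cis \<theta>) (T x))"
    if "\<phi> \<in> {0..pi}" for \<phi>
  proof -
    have "{0..\<phi>} = (\<lambda>\<theta>. min \<theta> \<phi>) ` {0..pi}"
      using that by (auto intro: image_eqI[of t _ t for t])
    then show ?thesis
      unfolding P_def by simp
  qed
  have Q_iff: "\<phi> \<in> Q \<longleftrightarrow> (\<exists>x\<in>norm_attain_set T. \<forall>\<theta>\<in>{\<phi>..pi}. A x \<in> plus_set (cis \<theta>) (T x))"
    if "\<phi> \<in> {0..pi}" for \<phi>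
  proof -
    have "{\<phi>..pi} = (\<lambda>\<theta>. max \<theta> \<phi>) ` {0..pi}"
      using that by (auto intro: image_eqI[of t _ t for t])
    then show ?thesis
      unfolding Q_def by simp
  qed
  have attaining: "\<exists>x\<in>norm_attain_set T. A x \<in> plus_set (cis \<phi>) (T x)" for \<phi>
    using bj_orthogonal_attains_direction[OF refl T A orth, of "cis \<phi>"] norm_attain_setI[OF _ _ False]
    by metis
  have "{0..pi} \<subseteq> P \<union> Q"
  proof
    fix \<phi> assume \<phi>: "\<phi> \<in> {0..pi}"
    obtain x where "x \<in> norm_attain_set T" "A x \<in> plus_set (cis \<phi>) (T x)"
      using attaining by blast
    then show "\<phi> \<in> P \<union> Q"
      using plus_set_sector[of "A x" \<phi> "T x"] \<phi> P_iff[OF \<phi>] Q_iff[OF \<phi>] by auto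
  qed
  moreover have "0 \<in> P" "pi \<in> Q"
    using P_iff[of 0] Q_iff[of pi] attaining[of 0] attaining[of pi] by auto
  ultimately have "P \<inter> Q \<inter> {0..pi} \<noteq> {}"
    using connected_Icc[of 0 pi] \<open>closed P\<close> \<open>closed Q\<close> unfolding connected_closed
    by (metis IntI atLeastAtMost_iff empty_iff order_refl pi_ge_zero)
  then obtain \<phi> where "\<phi> \<in> P" "\<phi> \<in> Q" and \<phi>: "\<phi> \<in> {0..pi}"
    by blast
  then show ?thesis
    using that P_iff[OF \<phi>] Q_iff[OF \<phi>] \<phi> by blast
qed

section \<open>The characterization\<close>

lemma ball_cis_iff_arg_in: "(\<forall>\<theta>\<in>I. P (cis \<theta>)) \<longleftrightarrow> (\<forall>\<alpha>. arg_in \<alpha> I \<longrightarrow> P \<alpha>)"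
  by (auto simp: arg_in_def cis_conv_exp)

lemma minus_set_conv_plus_set: "v \<in> minus_set \<alpha> u \<longleftrightarrow> - v \<in> plus_set \<alpha> u"
proof -
  have "(\<forall>t\<le>0. norm u \<le> norm (u + (complex_of_real t * \<alpha>) *\<^sub>C v))
     \<longleftrightarrow> (\<forall>t\<ge>0. norm u \<le> norm (u + (complex_of_real (- t) * \<alpha>) *\<^sub>C v))"
    by (metis neg_0_le_iff_le neg_le_0_iff_le minus_minus)
  then show ?thesis
    by (simp add: minus_set_def plus_set_def scaleC_minus_left scaleC_minus_right)
qed

lemma compact_operators_uminus:
  assumes "A \<in> compact_operators"
  shows "- A \<in> compact_operators"
proof -
  have "cblinfun_apply (- A) ` cball 0 1 = (*\<^sub>R) (- 1) ` cblinfun_apply A ` cball 0 1"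
    by (simp add: uminus_cblinfun.rep_eq image_image)
  then show ?thesis
    using assms compact_scaling[of _ "- 1"]
    by (simp only: compact_operators_def closure_scaleR[symmetric] mem_Collect_eq)
qed

lemma bj_orthogonal_uminus: "u \<bottom>\<^sub>B v \<Longrightarrow> u \<bottom>\<^sub>B - v"
  unfolding bj_orthogonal_def by (metis scaleC_minus_left scaleC_minus_right)

theorem theorem2p5:
  fixes T A :: "'x::{complex_normed_vector, banach} \<Rightarrow>\<^sub>C\<^sub>L 'y::{complex_normed_vector, banach}"
  assumes nonzero: "\<exists>x::'x. x \<noteq> 0"
    and reflexive: "reflexive_space TYPE('x)"
    and T: "T \<in> compact_operators"
    and A: "A \<in> compact_operators"
  shows "T \<bottom>\<^sub>B A \<longleftrightarrow>
    (\<exists>x \<in> norm_attain_set T. \<exists>y \<in> norm_attain_set T.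
     \<exists>z \<in> norm_attain_set T. \<exists>w \<in> norm_attain_set T.
     \<exists>\<phi>\<^sub>1 \<in> {0..pi}. \<exists>\<phi>\<^sub>2 \<in> {0..pi}.
      (\<forall>\<alpha>. arg_in \<alpha> {0..\<phi>\<^sub>1} \<longrightarrow> A x \<in> plus_set \<alpha> (T x)) \<and>
      (\<forall>\<alpha>. arg_in \<alpha> {\<phi>\<^sub>1..pi} \<longrightarrow> A y \<in> plus_set \<alpha> (T y)) \<and>
      (\<forall>\<alpha>. arg_in \<alpha> {0..\<phi>\<^sub>2} \<longrightarrow> A z \<in> minus_set \<alpha> (T z)) \<and>
      (\<forall>\<alpha>. arg_in \<alpha> {\<phi>\<^sub>2..pi} \<longrightarrow> A w \<in> minus_set \<alpha> (T w)))"
    (is "_ \<longleftrightarrow> ?R")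
proof
  assume orth: "T \<bottom>\<^sub>B A"
  obtain x y \<phi> where plus: "x \<in> norm_attain_set T" "y \<in> norm_attain_set T" "\<phi> \<in> {0..pi}"
    "\<forall>\<theta>\<in>{0..\<phi>}. A x \<in> plus_set (cis \<theta>) (T x)" "\<forall>\<theta>\<in>{\<phi>..pi}. A y \<in> plus_set (cis \<theta>) (T y)"
    using bj_orthogonal_two_attaining_vectors[OF nonzero reflexive T A orth] .
  obtain z w \<psi> where minus: "z \<in> norm_attain_set T" "w \<in> norm_attain_set T" "\<psi> \<in> {0..pi}"
    "\<forall>\<theta>\<in>{0..\<psi>}. (- A) z \<in> plus_set (cis \<theta>) (T z)" "\<forall>\<theta>\<in>{\<psi>..pi}. (- A) w \<in> plus_set (cis \<theta>) (T w)"
    using bj_orthogonal_two_attaining_vectors[OF nonzero reflexive T compact_operators_uminus[OF A]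
        bj_orthogonal_uminus[OF orth]] .
  show ?R
    unfolding ball_cis_iff_arg_in[symmetric] minus_set_conv_plus_set
    using plus minus[unfolded uminus_cblinfun.rep_eq] by blast
next
  assume ?R
  then obtain x y z w \<phi> \<psi> where M: "x \<in> norm_attain_set T" "y \<in> norm_attain_set T"
      "z \<in> norm_attain_set T" "w \<in> norm_attain_set T"
    and x: "\<And>\<theta>. \<theta> \<in> {0..\<phi>} \<Longrightarrow> A x \<in> plus_set (cis \<theta>) (T x)"
    and y: "\<And>\<theta>. \<theta> \<in> {\<phi>..pi} \<Longrightarrow> A y \<in> plus_set (cis \<theta>) (T y)"
    and z: "\<And>\<theta>. \<theta> \<in> {0..\<psi>} \<Longrightarrow> A z \<in> minus_set (cis \<theta>) (T z)"
    and w: "\<And>\<theta>. \<theta> \<in> {\<psi>..pi} \<Longrightarrow> A w \<in> minus_set (cis \<theta>) (T w)"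
    unfolding ball_cis_iff_arg_in[symmetric] by - (elim bexE conjE, rule that, (assumption | erule bspec)+)
  show "T \<bottom>\<^sub>B A"
    unfolding bj_orthogonal_def
  proof
    fix c :: complex
    have by_witness: "norm T \<le> norm (T + c *\<^sub>C A)"
      if "v \<in> norm_attain_set T" "norm (T v) \<le> norm (T v + c *\<^sub>C A v)" for v
      using that norm_cblinfun_le[of "T + c *\<^sub>C A" v]
      by (simp add: norm_attain_set_def plus_cblinfun.rep_eq scaleC_cblinfun.rep_eq)
    have polar: "c = complex_of_real (cmod c) * cis (Arg c)"
      using rcis_cmod_Arg[of c] by (simp add: rcis_def)
    show "norm T \<le> norm (T + c *\<^sub>C A)"
    proof (cases "0 \<le> Arg c")
      case True
      have in_plus: "norm (T v) \<le> norm (T v + c *\<^sub>C A v)" if "A v \<in> plus_set (cis (Arg c)) (T v)" for v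
        using that unfolding plus_set_def by (subst polar) simp
      show ?thesis
      proof (cases "Arg c \<le> \<phi>")
        case True
        then show ?thesis
          using \<open>0 \<le> Arg c\<close> by (intro by_witness[OF M(1)] in_plus x) simp
      next
        case False
        then show ?thesis
          using Arg_le_pi[of c] by (intro by_witness[OF M(2)] in_plus y) simp
      qed
    next
      case False
      \<comment> \<open>a direction in the lower half plane is a negative multiple of one in the upper half plane\<close>
      have "cis (Arg c) = - cis (Arg c + pi)"
        by (simp add: cis_mult[symmetric])
      then have "c = complex_of_real (- cmod c) * cis (Arg c + pi)"
        using polar by simp
      then have in_minus: "norm (T v) \<le> norm (T v + c *\<^sub>C A v)"
        if "A v \<in> minus_set (cis (Arg c + pi)) (T v)" for v
        using that unfolding minus_set_def by (metis (mono_tags, lifting) mem_Collect_eq neg_le_0_iff_le norm_ge_zero)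
      have range: "0 \<le> Arg c + pi" "Arg c + pi \<le> pi"
        using False mpi_less_Arg[of c] by simp_all
      show ?thesis
      proof (cases "Arg c + pi \<le> \<psi>")
        case True
        then show ?thesis
          using range by (intro by_witness[OF M(3)] in_minus z) simp
      next
        case False
        then show ?thesis
          using range by (intro by_witness[OF M(4)] in_minus w) simp
      qed
    qed
  qed
qed

end
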